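(* Let $V=\mathbb{F}_2^\omega$ be a countably infinite dimensional vector space over $\mathbb{F}_2$ and let $C\in V$ with $C\neq 0$. The lattice of first-order definable reducts of the pointed vector space $(V,C)$ contains an infinite ascending chain. In particular, $(V,C)$ has infinitely many first-order definable reducts (up to first-order equivalence).
   Context: The pointed vector space $(V,C)$ is the vector space $V$ (as a structure with addition and scalar multiplication) expanded by the constant $C$. A relational structure $\Gamma$ with the same domain as $\Delta$ is a (first-order definable) reduct of $\Delta$ if every relation of $\Gamma$ is first-order definable (without parameters) in $\Delta$; two structures on the same domain are first-order equivalent if each is a reduct of the other. Reducts are considered up to first-order equivalence and ordered by the reduct relation, forming a lattice. *)

theory Defs
  imports Complex_Main "HOL-Library.Z2" "HOL-Library.Countable_Set"
begin

section \<open>First-order logic with equality\<close>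

text \<open>Function symbols have type \<open>'f\<close>, relation symbols type \<open>'r\<close>; constants are function
  symbols of arity 0. The domain of a structure is the whole type \<open>'a\<close>.\<close>

record ('a, 'f, 'r) fo_structure =
  funs :: "'f set"
  farity :: "'f \<Rightarrow> nat"
  fint :: "'f \<Rightarrow> 'a list \<Rightarrow> 'a"
  rels :: "'r set"
  rarity :: "'r \<Rightarrow> nat"
  rint :: "'r \<Rightarrow> 'a list set"

datatype 'f tm = Var nat | App 'f "'f tm list"

datatype ('f, 'r) fm =
    Equal "'f tm" "'f tm"
  | Atom 'r "'f tm list"
  | Neg "('f, 'r) fm"
  | And "('f, 'r) fm" "('f, 'r) fm"
  | Exists nat "('f, 'r) fm"

fun tm_wf :: "('a, 'f, 'r) fo_structure \<Rightarrow> 'f tm \<Rightarrow> bool" where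
  "tm_wf M (Var i) \<longleftrightarrow> True"
| "tm_wf M (App f ts) \<longleftrightarrow> f \<in> funs M \<and> length ts = farity M f \<and> (\<forall>t\<in>set ts. tm_wf M t)"

fun fm_wf :: "('a, 'f, 'r) fo_structure \<Rightarrow> ('f, 'r) fm \<Rightarrow> bool" where
  "fm_wf M (Equal s t) \<longleftrightarrow> tm_wf M s \<and> tm_wf M t"
| "fm_wf M (Atom r ts) \<longleftrightarrow> r \<in> rels M \<and> length ts = rarity M r \<and> (\<forall>t\<in>set ts. tm_wf M t)"
| "fm_wf M (Neg \<phi>) \<longleftrightarrow> fm_wf M \<phi>"
| "fm_wf M (And \<phi> \<psi>) \<longleftrightarrow> fm_wf M \<phi> \<and> fm_wf M \<psi>"
| "fm_wf M (Exists i \<phi>) \<longleftrightarrow> fm_wf M \<phi>"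

fun tm_vars :: "'f tm \<Rightarrow> nat set" where
  "tm_vars (Var i) = {i}"
| "tm_vars (App f ts) = (\<Union>t\<in>set ts. tm_vars t)"

fun fm_free :: "('f, 'r) fm \<Rightarrow> nat set" where
  "fm_free (Equal s t) = tm_vars s \<union> tm_vars t"
| "fm_free (Atom r ts) = (\<Union>t\<in>set ts. tm_vars t)"
| "fm_free (Neg \<phi>) = fm_free \<phi>"
| "fm_free (And \<phi> \<psi>) = fm_free \<phi> \<union> fm_free \<psi>"
| "fm_free (Exists i \<phi>) = fm_free \<phi> - {i}"

fun tm_val :: "('a, 'f, 'r) fo_structure \<Rightarrow> (nat \<Rightarrow> 'a) \<Rightarrow> 'f tm \<Rightarrow> 'a" where
  "tm_val M e (Var i) = e i"
| "tm_val M e (App f ts) = fint M f (map (tm_val M e) ts)"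

fun fm_sat :: "('a, 'f, 'r) fo_structure \<Rightarrow> (nat \<Rightarrow> 'a) \<Rightarrow> ('f, 'r) fm \<Rightarrow> bool" where
  "fm_sat M e (Equal s t) \<longleftrightarrow> tm_val M e s = tm_val M e t"
| "fm_sat M e (Atom r ts) \<longleftrightarrow> map (tm_val M e) ts \<in> rint M r"
| "fm_sat M e (Neg \<phi>) \<longleftrightarrow> \<not> fm_sat M e \<phi>"
| "fm_sat M e (And \<phi> \<psi>) \<longleftrightarrow> fm_sat M e \<phi> \<and> fm_sat M e \<psi>"
| "fm_sat M e (Exists i \<phi>) \<longleftrightarrow> (\<exists>x. fm_sat M (e(i := x)) \<phi>)"

text \<open>Definability without parameters: the free variables are among those numbered
  \<open>0, \<dots>, n - 1\<close>, which are assigned the entries of the tuple.\<close>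

definition fo_definable :: "('a, 'f, 'r) fo_structure \<Rightarrow> nat \<Rightarrow> 'a list set \<Rightarrow> bool" where
  "fo_definable M n R \<longleftrightarrow>
     (\<exists>\<phi>. fm_wf M \<phi> \<and> fm_free \<phi> \<subseteq> {..<n} \<and>
          R = {xs. length xs = n \<and> fm_sat M (\<lambda>i. xs ! i) \<phi>})"


section \<open>Reducts\<close>

text \<open>Definability depends only on which relations a relational structure has, not on how they
  are named. A relational structure on \<open>'a\<close>, of any signature, is therefore given by its
  set of relations, each paired with its arity and used as its own symbol.\<close>

type_synonym 'a rels = "(nat \<times> 'a list set) set"

definition rel_structure :: "'a rels \<Rightarrow> ('a, unit, nat \<times> 'a list set) fo_structure" where
  "rel_structure \<Gamma> =
     \<lparr>funs = {}, farity = (\<lambda>_. 0), fint = (\<lambda>_ _. undefined),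
      rels = \<Gamma>, rarity = fst, rint = snd\<rparr>"

text \<open>If \<open>\<Gamma>\<close> is a reduct of some structure, then each of its relations consists of tuples of
  the stated arity, by the definition of \<open>fo_definable\<close>.\<close>

definition fo_reduct :: "'a rels \<Rightarrow> ('a, 'f, 'r) fo_structure \<Rightarrow> bool" where
  "fo_reduct \<Gamma> M \<longleftrightarrow> (\<forall>(n, R)\<in>\<Gamma>. fo_definable M n R)"

definition fo_equivalent :: "'a rels \<Rightarrow> 'a rels \<Rightarrow> bool" where
  "fo_equivalent \<Gamma> \<Delta> \<longleftrightarrow>
     fo_reduct \<Gamma> (rel_structure \<Delta>) \<and> fo_reduct \<Delta> (rel_structure \<Gamma>)"

definition reduct_lattice :: "('a, 'f, 'r) fo_structure \<Rightarrow> 'a rels set set" where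
  "reduct_lattice M =
     {\<Gamma>. fo_reduct \<Gamma> M} //
     {(\<Gamma>, \<Delta>). fo_reduct \<Gamma> M \<and> fo_reduct \<Delta> M \<and> fo_equivalent \<Gamma> \<Delta>}"

text \<open>Orientation of the lattice: \<open>X\<close> lies below \<open>Y\<close> if the structures in \<open>Y\<close> are reducts of those
  in \<open>X\<close>. So the original structure is at the bottom and the pure set at the top; for an
  \<open>\<omega>\<close>-categorical structure such as the pointed space this is inclusion of the (closed)
  automorphism groups. Going up the lattice means having fewer definable relations.\<close>

definition reduct_le :: "'a rels set \<Rightarrow> 'a rels set \<Rightarrow> bool" where
  "reduct_le X Y \<longleftrightarrow> (\<exists>\<Gamma>\<in>X. \<exists>\<Delta>\<in>Y. fo_reduct \<Delta> (rel_structure \<Gamma>))"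

definition reduct_less :: "'a rels set \<Rightarrow> 'a rels set \<Rightarrow> bool" where
  "reduct_less X Y \<longleftrightarrow> reduct_le X Y \<and> X \<noteq> Y"


section \<open>The pointed vector space\<close>

definition countably_infinite_dimensional ::
    "('k::field \<Rightarrow> 'v::ab_group_add \<Rightarrow> 'v) \<Rightarrow> bool" where
  "countably_infinite_dimensional scale \<longleftrightarrow>
     (\<exists>B. countable B \<and> infinite B \<and> \<not> module.dependent scale B \<and> module.span scale B = UNIV)"

datatype 'k vs_fun = Plus | Scale 'k | Point

fun vs_arity :: "'k vs_fun \<Rightarrow> nat" where
  "vs_arity Plus = 2"
| "vs_arity (Scale c) = 1"
| "vs_arity Point = 0"

fun vs_fint :: "('k \<Rightarrow> 'v::ab_group_add \<Rightarrow> 'v) \<Rightarrow> 'v \<Rightarrow> 'k vs_fun \<Rightarrow> 'v list \<Rightarrow> 'v" where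
  "vs_fint scale C Plus [x, y] = x + y"
| "vs_fint scale C (Scale c) [x] = scale c x"
| "vs_fint scale C Point [] = C"
| "vs_fint scale C f xs = undefined"

text \<open>The signature has no relation symbols, so their type is irrelevant.\<close>

definition pointed_vector_space ::
    "('k \<Rightarrow> 'v::ab_group_add \<Rightarrow> 'v) \<Rightarrow> 'v \<Rightarrow> ('v, 'k vs_fun, unit) fo_structure" where
  "pointed_vector_space scale C =
     \<lparr>funs = UNIV, farity = vs_arity, fint = vs_fint scale C,
      rels = {}, rarity = (\<lambda>_. 0), rint = (\<lambda>_. {})\<rparr>"

end

theory Submission
  imports Defs
begin

text \<open>
  Let \<open>T n\<close> be the set of involutions \<open>x \<mapsto> x + h x\<close>, where \<open>h\<close> takes values in \<open>{0, C}\<close>, is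
  invariant under translation by \<open>C\<close>, and is a polynomial function of degree less than \<open>n\<close>. The
  sets \<open>T n\<close> increase with \<open>n\<close>, so the structures \<open>\<Gamma> n\<close> consisting of all definable relations
  preserved by \<open>T n\<close> form a chain. A polynomial function of degree less than \<open>n\<close> sums to zero over
  every \<open>n\<close>-dimensional cube. Hence the relation ``the entries form an \<open>n\<close>-dimensional cube modulo
  \<open>C\<close> and add up to \<open>0\<close>'' belongs to \<open>\<Gamma> n\<close>. For \<open>n \<ge> 2\<close> it is not preserved by the involution in
  \<open>T (n + 1)\<close> given by a product of \<open>n\<close> coordinate functions, so it is not even first-order
  definable in \<open>\<Gamma> (n + 1)\<close>. (For \<open>n \<ge> 2\<close> the vertices of an actual cube do add up to \<open>0\<close>.)
\<close>

section \<open>Definable relations\<close>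

lemma tm_val_cong:
  "(\<And>i. i \<in> tm_vars t \<Longrightarrow> e i = e' i) \<Longrightarrow> tm_val M e t = tm_val M e' t"
proof (induction t)
  case (App f ts)
  then have "map (tm_val M e) ts = map (tm_val M e') ts"
    by (auto intro!: map_cong)
  then show ?case
    by (simp only: tm_val.simps)
qed simp

lemma fm_sat_cong:
  "(\<And>i. i \<in> fm_free \<phi> \<Longrightarrow> e i = e' i) \<Longrightarrow> fm_sat M e \<phi> \<longleftrightarrow> fm_sat M e' \<phi>"
proof (induction \<phi> arbitrary: e e')
  case (Equal s t)
  then show ?case
    using tm_val_cong[of s e e' M] tm_val_cong[of t e e' M] by auto
next
  case (Atom r ts)
  then have "map (tm_val M e) ts = map (tm_val M e') ts"
    by (auto intro!: map_cong tm_val_cong)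
  then show ?case
    by (simp only: fm_sat.simps)
next
  case (Neg \<phi>)
  then show ?case by (metis fm_free.simps(3) fm_sat.simps(3))
next
  case (And \<phi> \<psi>)
  have "fm_sat M e \<phi> \<longleftrightarrow> fm_sat M e' \<phi>" "fm_sat M e \<psi> \<longleftrightarrow> fm_sat M e' \<psi>"
    by (rule And.IH; simp add: And.prems)+
  then show ?case by simp
next
  case (Exists i \<phi>)
  have "fm_sat M (e(i := x)) \<phi> \<longleftrightarrow> fm_sat M (e'(i := x)) \<phi>" for x
    by (rule Exists.IH) (simp add: Exists.prems)
  then show ?case by simp
qed

section \<open>Boolean closure of parameter-free definability\<close>

lemma fo_definable_neg:
  assumes "fo_definable M n {xs. length xs = n \<and> P xs}"
  shows "fo_definable M n {xs. length xs = n \<and> \<not> P xs}"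
proof -
  obtain \<phi> where \<phi>: "fm_wf M \<phi>" "fm_free \<phi> \<subseteq> {..<n}"
    "{xs. length xs = n \<and> P xs} = {xs. length xs = n \<and> fm_sat M (\<lambda>i. xs ! i) \<phi>}"
    using assms unfolding fo_definable_def by blast
  show ?thesis
    unfolding fo_definable_def by (rule exI[of _ "Neg \<phi>"]) (use \<phi> in auto)
qed

lemma fo_definable_conj:
  assumes "fo_definable M n {xs. length xs = n \<and> P xs}"
    and "fo_definable M n {xs. length xs = n \<and> Q xs}"
  shows "fo_definable M n {xs. length xs = n \<and> P xs \<and> Q xs}"
proof -
  obtain \<phi> where \<phi>: "fm_wf M \<phi>" "fm_free \<phi> \<subseteq> {..<n}"
    "{xs. length xs = n \<and> P xs} = {xs. length xs = n \<and> fm_sat M (\<lambda>i. xs ! i) \<phi>}"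
    using assms(1) unfolding fo_definable_def by blast
  obtain \<psi> where \<psi>: "fm_wf M \<psi>" "fm_free \<psi> \<subseteq> {..<n}"
    "{xs. length xs = n \<and> Q xs} = {xs. length xs = n \<and> fm_sat M (\<lambda>i. xs ! i) \<psi>}"
    using assms(2) unfolding fo_definable_def by blast
  show ?thesis
    unfolding fo_definable_def by (rule exI[of _ "And \<phi> \<psi>"]) (use \<phi> \<psi> in auto)
qed

lemma fo_definable_disj:
  assumes "fo_definable M n {xs. length xs = n \<and> P xs}"
    and "fo_definable M n {xs. length xs = n \<and> Q xs}"
  shows "fo_definable M n {xs. length xs = n \<and> (P xs \<or> Q xs)}"
  using fo_definable_neg[OF fo_definable_conj[OF assms[THEN fo_definable_neg]]] by simp

lemma fo_definable_True: "fo_definable M n {xs. length xs = n \<and> True}"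
  unfolding fo_definable_def
  \<comment> \<open>The quantifier closes the formula, so that it also serves \<open>n = 0\<close>,
    where no free variable is allowed.\<close>
  by (rule exI[of _ "Exists 0 (Equal (Var 0) (Var 0))"]) auto

lemma fo_definable_ball:
  assumes "finite I" and "\<And>i. i \<in> I \<Longrightarrow> fo_definable M n {xs. length xs = n \<and> P i xs}"
  shows "fo_definable M n {xs. length xs = n \<and> (\<forall>i\<in>I. P i xs)}"
  using assms
proof (induction I rule: finite_induct)
  case empty
  then show ?case using fo_definable_True by simp
next
  case (insert j I)
  then show ?case
    using fo_definable_conj[of M n "P j" "\<lambda>xs. \<forall>i\<in>I. P i xs"] by simp
qed

lemma fo_definable_length: "fo_definable M n R \<Longrightarrow> xs \<in> R \<Longrightarrow> length xs = n"
  unfolding fo_definable_def by auto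

section \<open>Invariance of definable relations under automorphisms\<close>

definition preserves :: "('a \<Rightarrow> 'a) \<Rightarrow> 'a list set \<Rightarrow> bool" where
  "preserves g R \<longleftrightarrow> (\<forall>xs. map g xs \<in> R \<longleftrightarrow> xs \<in> R)"

text \<open>Such a \<open>g\<close> is an automorphism: injectivity settles equality, surjectivity
  the quantifier. There are no function symbols, so well-formed terms are variables.\<close>

lemma fm_sat_bij_comp:
  assumes "bij g" and "\<And>n R. (n, R) \<in> \<Gamma> \<Longrightarrow> preserves g R"
  shows "fm_wf (rel_structure \<Gamma>) \<phi> \<Longrightarrow>
    fm_sat (rel_structure \<Gamma>) (g \<circ> e) \<phi> \<longleftrightarrow> fm_sat (rel_structure \<Gamma>) e \<phi>"
proof (induction \<phi> arbitrary: e)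
  have tm: "tm_val (rel_structure \<Gamma>) (g \<circ> e) t = g (tm_val (rel_structure \<Gamma>) e t)"
    if "tm_wf (rel_structure \<Gamma>) t" for t e
    using that by (cases t) (auto simp: rel_structure_def)
  {
    case (Equal s t)
    then have "tm_wf (rel_structure \<Gamma>) s" "tm_wf (rel_structure \<Gamma>) t"
      by auto
    then show ?case
      by (simp only: fm_sat.simps tm inj_eq[OF bij_is_inj[OF assms(1)]])
  next
    case (Atom r ts)
    then have "map (tm_val (rel_structure \<Gamma>) (g \<circ> e)) ts
        = map g (map (tm_val (rel_structure \<Gamma>) e) ts)"
      by (simp add: tm)
    moreover have "preserves g (snd r)"
      using assms(2)[of "fst r" "snd r"] Atom by (simp add: rel_structure_def)
    moreover have "rint (rel_structure \<Gamma>) r = snd r"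
      by (simp add: rel_structure_def)
    ultimately show ?case
      by (simp only: fm_sat.simps preserves_def)
  next
    case (Neg \<phi>)
    then show ?case by simp
  next
    case (And \<phi> \<psi>)
    then show ?case by simp
  next
    case (Exists i \<phi>)
    have "(g \<circ> e)(i := g x) = g \<circ> (e(i := x))" for x
      by auto
    moreover have "fm_wf (rel_structure \<Gamma>) \<phi>"
      using Exists.prems by simp
    ultimately have "fm_sat (rel_structure \<Gamma>) ((g \<circ> e)(i := g x)) \<phi>
        \<longleftrightarrow> fm_sat (rel_structure \<Gamma>) (e(i := x)) \<phi>" for x
      by (simp only: Exists.IH)
    then show ?case
      using bij_is_surj[OF assms(1)] by (metis fm_sat.simps(5) surjD)
  }
qed

lemma fo_definable_preserves:
  assumes "fo_definable (rel_structure \<Gamma>) n R" and "bij g"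
    and "\<And>n R. (n, R) \<in> \<Gamma> \<Longrightarrow> preserves g R"
  shows "preserves g R"
  unfolding preserves_def
proof
  fix xs
  obtain \<phi> where \<phi>: "fm_wf (rel_structure \<Gamma>) \<phi>" "fm_free \<phi> \<subseteq> {..<n}"
    "R = {xs. length xs = n \<and> fm_sat (rel_structure \<Gamma>) (\<lambda>i. xs ! i) \<phi>}"
    using assms(1) unfolding fo_definable_def by blast
  have "fm_sat (rel_structure \<Gamma>) (\<lambda>i. map g xs ! i) \<phi>
      \<longleftrightarrow> fm_sat (rel_structure \<Gamma>) (g \<circ> (\<lambda>i. xs ! i)) \<phi>" if "length xs = n"
    by (rule fm_sat_cong) (use \<phi>(2) that in auto)
  then show "map g xs \<in> R \<longleftrightarrow> xs \<in> R"
    using fm_sat_bij_comp[OF assms(2,3) \<phi>(1)] \<phi>(3) by auto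
qed

text \<open>Each relation is its own symbol, so an atomic formula defines it. Being a reduct of
  \<open>M\<close> guarantees that all its tuples have the stated arity.\<close>

lemma fo_reduct_rel_structure_mono:
  assumes "\<Gamma> \<subseteq> \<Delta>" and "fo_reduct \<Gamma> M"
  shows "fo_reduct \<Gamma> (rel_structure \<Delta>)"
  unfolding fo_reduct_def
proof clarify
  fix n R assume nR: "(n, R) \<in> \<Gamma>"
  then have "xs \<in> R \<Longrightarrow> length xs = n" for xs
    using assms(2) fo_definable_length unfolding fo_reduct_def by fastforce
  moreover have "fm_sat (rel_structure \<Delta>) ((!) xs) (Atom (n, R) (map Var [0..<n])) \<longleftrightarrow> xs \<in> R"
    if "length xs = n" for xs
    using map_nth[of xs] that by (simp add: rel_structure_def comp_def)
  ultimately have "R = {xs. length xs = n \<and>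
      fm_sat (rel_structure \<Delta>) ((!) xs) (Atom (n, R) (map Var [0..<n]))}"
    by blast
  moreover have "fm_wf (rel_structure \<Delta>) (Atom (n, R) (map Var [0..<n]))"
    using assms(1) nR by (auto simp: rel_structure_def)
  moreover have "fm_free (Atom (n, R) (map Var [0..<n])) \<subseteq> {..<n}"
    by auto
  ultimately show "fo_definable (rel_structure \<Delta>) n R"
    unfolding fo_definable_def by metis
qed


section \<open>Polynomial functions\<close>

text \<open>On abelian groups, a function has degree less than \<open>n\<close> if all its \<open>n\<close>-fold differences
  vanish.\<close>

primrec poly_fun :: "nat \<Rightarrow> ('a::ab_group_add \<Rightarrow> 'b::ab_group_add) \<Rightarrow> bool" where
  "poly_fun 0 f \<longleftrightarrow> (\<forall>x. f x = 0)"
| "poly_fun (Suc n) f \<longleftrightarrow> (\<forall>v. poly_fun n (\<lambda>x. f (x + v) - f x))"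

lemma poly_fun_0: "poly_fun n (\<lambda>x. 0)"
  by (induction n) auto

lemma poly_fun_add: "poly_fun n f \<Longrightarrow> poly_fun n g \<Longrightarrow> poly_fun n (\<lambda>x. f x + g x)"
proof (induction n arbitrary: f g)
  case (Suc n)
  have "poly_fun n (\<lambda>x. (f (x + v) - f x) + (g (x + v) - g x))" for v
    by (rule Suc.IH) (use Suc.prems in auto)
  then show ?case by (simp add: algebra_simps)
qed simp

lemma poly_fun_translate: "poly_fun n f \<Longrightarrow> poly_fun n (\<lambda>x. f (x + a))"
proof (induction n arbitrary: f)
  case (Suc n)
  have "poly_fun n (\<lambda>x. f (x + a + v) - f (x + a))" for v
    by (rule Suc.IH[of "\<lambda>x. f (x + v) - f x"]) (use Suc.prems in auto)
  then show ?case by (simp add: ac_simps)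
qed simp

lemma poly_fun_Suc: "poly_fun n f \<Longrightarrow> poly_fun (Suc n) f"
  by (induction n arbitrary: f) auto

lemma poly_fun_mono: "n \<le> m \<Longrightarrow> poly_fun n f \<Longrightarrow> poly_fun m f"
  by (induction rule: dec_induct) (use poly_fun_Suc in blast)+

lemma sum_lessThan_add:
  fixes f :: "nat \<Rightarrow> 'a::comm_monoid_add"
  shows "(\<Sum>i<m + k. f i) = (\<Sum>i<m. f i) + (\<Sum>i<k. f (i + m))"
  by (induction k) (simp_all add: ac_simps)

text \<open>Adding \<open>2 ^ n\<close> sets the top binary digit of the index, so on a cube this
  pairs the vertices of two opposite faces.\<close>

lemma sum_lessThan_power2_Suc:
  fixes f :: "nat \<Rightarrow> 'a::comm_monoid_add"
  shows "(\<Sum>i<2 ^ Suc n. f i) = (\<Sum>i<2 ^ n. f i + f (i + 2 ^ n))"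
  using sum_lessThan_add[of f "2 ^ n" "2 ^ n"] by (simp add: mult_2 sum.distrib)


section \<open>Cubes in a vector space over the field with two elements\<close>

locale bit_vector_space = vector_space scale
  for scale :: "bit \<Rightarrow> 'v::ab_group_add \<Rightarrow> 'v"
begin

lemma add_self [simp]: "x + x = (0::'v)"
  using scale_left_distrib[of 1 1 x] by simp

lemma add_self_left [simp]: "x + (x + y) = (y::'v)"
  by (simp flip: add.assoc)

lemma minus_eq_add: "x - y = x + (y::'v)"
  by (simp add: diff_eq_eq add.assoc)

lemma scale_bit_cases: "scale c x \<in> {0, x}"
  by (cases "c = 0") simp_all

lemma poly_fun_scale:
  "poly_fun n (f :: 'v \<Rightarrow> 'v) \<Longrightarrow> poly_fun n (\<lambda>x. scale c (f x))"
  by (cases "c = 0") (simp_all add: poly_fun_0)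

text \<open>Product rule: the difference in direction \<open>v\<close> is \<open>l x\<close> times
  the difference of \<open>f\<close>, covered by induction, plus the constant \<open>l v\<close>
  times a translate of \<open>f\<close>.\<close>

lemma poly_fun_mult_additive:
  assumes add: "\<And>x y. l (x + y) = l x + l y"
  shows "poly_fun n (f :: 'v \<Rightarrow> 'v) \<Longrightarrow> poly_fun (Suc n) (\<lambda>x. scale (l x) (f x))"
proof (induction n arbitrary: f)
  case (Suc n)
  have "poly_fun (Suc n) (\<lambda>x. scale (l x) (f (x + v) - f x) + scale (l v) (f (x + v)))" for v
    by (intro poly_fun_add poly_fun_scale poly_fun_translate Suc.IH) (use Suc.prems in auto)
  moreover have "scale (l (x + v)) (f (x + v)) - scale (l x) (f x)
      = scale (l x) (f (x + v) - f x) + scale (l v) (f (x + v))" for x v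
    by (simp only: add scale_left_distrib scale_right_distrib minus_eq_add ac_simps)
  ultimately show ?case
    unfolding poly_fun.simps(2)[of "Suc n"] by presburger
qed simp

text \<open>The entry with index \<open>i\<close> of a cube is the vertex given by the binary digits of \<open>i\<close>.\<close>

definition cube_mod :: "'v \<Rightarrow> nat \<Rightarrow> (nat \<Rightarrow> 'v) \<Rightarrow> bool" where
  "cube_mod C n x \<longleftrightarrow>
    (\<forall>m\<in>{..<n}. \<forall>i\<in>{..<2 ^ m}. x i + x (i + 2 ^ m) + x 0 + x (2 ^ m) \<in> {0, C})"

text \<open>Opposite vertices in the last direction differ by a fixed \<open>v\<close> up to
  \<open>C\<close>, which \<open>h\<close> does not see. In characteristic 2 the sum is therefore a
  sum of differences of \<open>h\<close> over a face, and these have lower degree.\<close>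

lemma poly_fun_sum_cube:
  assumes "\<And>x. h (x + C) = h x" and "poly_fun n h" and "cube_mod C n x"
  shows "(\<Sum>i<2 ^ n. h (x i)) = (0::'v)"
  using assms
proof (induction n arbitrary: h)
  case (Suc n)
  define v where "v = x 0 + x (2 ^ n)"
  have "h (x (i + 2 ^ n)) = h (x i + v)" if "i < 2 ^ n" for i
  proof -
    define u where "u = x i + x (i + 2 ^ n) + x 0 + x (2 ^ n)"
    have "u \<in> {0, C}"
      using Suc.prems(3) that unfolding cube_mod_def u_def by blast
    moreover have "x (i + 2 ^ n) = x i + v + u"
      by (simp add: u_def v_def ac_simps)
    ultimately show ?thesis
      using Suc.prems(1) by auto
  qed
  then have "(\<Sum>i<2 ^ Suc n. h (x i)) = (\<Sum>i<2 ^ n. h (x i + v) - h (x i))"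
    unfolding sum_lessThan_power2_Suc by (simp add: minus_eq_add add.commute)
  also have "\<dots> = 0"
  proof (rule Suc.IH)
    show "h (x + C + v) - h (x + C) = h (x + v) - h x" for x
      using Suc.prems(1) by (metis add.commute add.left_commute)
    show "poly_fun n (\<lambda>x. h (x + v) - h x)"
      using Suc.prems(2) by simp
    show "cube_mod C n x"
      using Suc.prems(3) by (simp add: cube_mod_def)
  qed
  finally show ?case .
qed simp

text \<open>For \<open>n >= 2\<close> the entries of any cube modulo \<open>C\<close> add up to
  \<open>0\<close> or \<open>C\<close>. Prescribing \<open>0\<close> makes the relation sensitive to
  the sum of \<open>h\<close> over the cube.\<close>

definition zero_cubes :: "'v \<Rightarrow> nat \<Rightarrow> 'v list set" where
  "zero_cubes C n = {xs. length xs = 2 ^ n \<and>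
     cube_mod C n (\<lambda>i. xs ! i) \<and> (\<Sum>i<2 ^ n. xs ! i) = 0}"

section \<open>The involutions and their action on cubes\<close>

definition shears :: "'v \<Rightarrow> nat \<Rightarrow> ('v \<Rightarrow> 'v) set" where
  "shears C n = {\<lambda>x. x + h x |h. range h \<subseteq> {0, C} \<and> (\<forall>x. h (x + C) = h x) \<and> poly_fun n h}"

lemma shears_mono: "n \<le> m \<Longrightarrow> shears C n \<subseteq> shears C m"
  unfolding shears_def using poly_fun_mono by blast

text \<open>The displacement \<open>h x\<close> is \<open>0\<close> or \<open>C\<close>, hence
  \<open>h\<close> has the same value at \<open>x + h x\<close>, and the two displacements
  cancel.\<close>

lemma shear_shear:
  assumes "g \<in> shears C n"
  shows "g (g x) = x"
proof -
  obtain h where g: "g = (\<lambda>x. x + h x)" and h: "range h \<subseteq> {0, C}" "\<And>x. h (x + C) = h x"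
    using assms unfolding shears_def by blast
  have "h x \<in> {0, C}"
    using h(1) by auto
  then have "h (x + h x) = h x"
    using h(2) by auto
  then show ?thesis
    by (simp add: g add.assoc)
qed

lemma bij_shear: "g \<in> shears C n \<Longrightarrow> bij g"
  by (rule o_bij[of g]) (auto simp: shear_shear)

text \<open>Entries move by elements of the subgroup \<open>{0, C}\<close>, so the cube condition
  survives; the total changes by the sum of \<open>h\<close> over the cube, which vanishes for
  reasons of degree.\<close>

lemma shear_zero_cubes:
  assumes "g \<in> shears C n" and xs: "xs \<in> zero_cubes C n"
  shows "map g xs \<in> zero_cubes C n"
proof -
  obtain h where g: "g = (\<lambda>x. x + h x)" and h: "range h \<subseteq> {0, C}" "\<And>x. h (x + C) = h x"
    and poly: "poly_fun n h"
    using assms(1) unfolding shears_def by blast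
  have len: "length xs = 2 ^ n" and cube: "cube_mod C n ((!) xs)"
    and sum: "(\<Sum>i<2 ^ n. xs ! i) = 0"
    using xs by (auto simp: zero_cubes_def)
  have closed: "a + b \<in> {0, C}" if "a \<in> {0, C}" "b \<in> {0, C}" for a b
    using that by auto
  have h0: "h x \<in> {0, C}" for x
    using h(1) by auto
  have nth: "map g xs ! i = xs ! i + h (xs ! i)" if "i < 2 ^ n" for i
    using that by (simp add: len g)
  have "map g xs ! i + map g xs ! (i + 2 ^ m) + map g xs ! 0 + map g xs ! (2 ^ m) \<in> {0, C}"
    if "m < n" "i < 2 ^ m" for m i
  proof -
    have "(2::nat) ^ Suc m \<le> 2 ^ n"
      using that(1) by (intro power_increasing) auto
    then have lt: "i < 2 ^ n" "i + 2 ^ m < 2 ^ n" "0 < (2::nat) ^ n" "(2::nat) ^ m < 2 ^ n"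
      using that by auto
    have "(xs ! i + xs ! (i + 2 ^ m) + xs ! 0 + xs ! (2 ^ m)) +
        (h (xs ! i) + h (xs ! (i + 2 ^ m)) + h (xs ! 0) + h (xs ! (2 ^ m))) \<in> {0, C}"
      by (rule closed) (use cube that in \<open>unfold cube_mod_def, blast\<close>, intro closed h0)
    then show ?thesis
      unfolding lt[THEN nth] by (simp only: ac_simps)
  qed
  then have "cube_mod C n ((!) (map g xs))"
    unfolding cube_mod_def by blast
  moreover have "(\<Sum>i<2 ^ n. map g xs ! i) = 0"
    using poly_fun_sum_cube[OF h(2) poly cube] sum by (simp add: nth sum.distrib)
  ultimately show ?thesis
    by (simp add: zero_cubes_def len)
qed

lemma preserves_zero_cubes:
  assumes "g \<in> shears C n"
  shows "preserves g (zero_cubes C n)"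
  unfolding preserves_def
proof (intro allI iffI)
  fix xs
  assume "map g xs \<in> zero_cubes C n"
  then have "map g (map g xs) \<in> zero_cubes C n"
    by (rule shear_zero_cubes[OF assms])
  then show "xs \<in> zero_cubes C n"
    by (simp add: comp_def shear_shear[OF assms])
qed (rule shear_zero_cubes[OF assms])


subsection \<open>Definability of the cube relation\<close>

lemma fo_definable_sum_list_eq:
  assumes "set js \<subseteq> {..<n}"
  shows "fo_definable (pointed_vector_space scale C) n
    {xs. length xs = n \<and> (\<Sum>j\<leftarrow>js. xs ! j) = scale c C}"
proof -
  let ?M = "pointed_vector_space scale C"
  let ?P = "App Point []"
  \<comment> \<open>The signature has no symbol for the zero vector; scaling the point by
    \<open>0\<close> supplies it.\<close>
  let ?t = "foldr (\<lambda>j t. App Plus [Var j, t]) js (App (Scale 0) [?P])"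
  have "tm_val ?M e ?t = (\<Sum>j\<leftarrow>js. e j)" for e
    by (induction js) (auto simp: pointed_vector_space_def)
  moreover have "tm_wf ?M ?t"
    by (induction js) (auto simp: pointed_vector_space_def)
  moreover have "tm_vars ?t = set js"
    by (induction js) auto
  ultimately show ?thesis
    unfolding fo_definable_def using assms
    by (intro exI[of _ "Equal ?t (App (Scale c) [?P])"]) (auto simp: pointed_vector_space_def)
qed

lemma fo_definable_zero_cubes:
  "fo_definable (pointed_vector_space scale C) (2 ^ n) (zero_cubes C n)"
proof -
  let ?M = "pointed_vector_space scale C"
  have "fo_definable ?M (2 ^ n) {xs. length xs = 2 ^ n \<and>
      xs ! i + xs ! (i + 2 ^ m) + xs ! 0 + xs ! (2 ^ m) \<in> {0, C}}"
    if "m < n" "i < 2 ^ m" for m i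
  proof -
    have "(2::nat) ^ Suc m \<le> 2 ^ n"
      using that(1) by (intro power_increasing) auto
    then have "set [i, i + 2 ^ m, 0, 2 ^ m] \<subseteq> {..<(2::nat) ^ n}"
      using that by auto
    note d = fo_definable_sum_list_eq[OF this, of C]
    show ?thesis
      \<comment> \<open>The scalars \<open>0\<close> and \<open>1\<close> give the two members of
        \<open>{0, C}\<close>.\<close>
      using fo_definable_disj[OF d[of 0] d[of 1]] by (simp add: add.assoc)
  qed
  then have "fo_definable ?M (2 ^ n) {xs. length xs = 2 ^ n \<and> cube_mod C n ((!) xs)}"
    unfolding cube_mod_def by (intro fo_definable_ball) auto
  moreover have "fo_definable ?M (2 ^ n) {xs. length xs = 2 ^ n \<and> (\<Sum>i<2 ^ n. xs ! i) = 0}"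
    using fo_definable_sum_list_eq[of "[0..<2 ^ n]" "2 ^ n" C 0]
    by (simp add: interv_sum_list_conv_sum_set_nat atLeast0LessThan)
  ultimately show ?thesis
    unfolding zero_cubes_def by (rule fo_definable_conj)
qed


subsection \<open>A shear that does not preserve the cube relation\<close>

text \<open>In a basis containing \<open>C\<close>, the coordinates at the other basis vectors
  vanish on \<open>C\<close>. The basis is infinite because a finite spanning set bounds the size of
  independent sets.\<close>

lemma exists_coordinates:
  assumes "countably_infinite_dimensional scale" and "C \<noteq> 0"
  obtains b :: "nat \<Rightarrow> 'v" and l :: "nat \<Rightarrow> 'v \<Rightarrow> bit"
  where "\<And>m x y. l m (x + y) = l m x + l m y" and "\<And>m. l m C = 0"
    and "\<And>m k. l m (b k) = (if m = k then 1 else 0)"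
proof -
  define B where "B = extend_basis {C}"
  have C: "independent {C}"
    using assms(2) by simp
  have B: "{C} \<subseteq> B" "independent B" "span B = UNIV"
    unfolding B_def
    by (rule extend_basis_superset[OF C] independent_extend_basis[OF C] span_extend_basis[OF C])+
  obtain A where "infinite A" "independent A"
    using assms(1) unfolding countably_infinite_dimensional_def by blast
  then have "infinite B"
    using independent_span_bound[of B A] B(3) by auto
  then have "infinite (B - {C})"
    by simp
  then obtain b :: "nat \<Rightarrow> 'v" where b: "inj b" "range b \<subseteq> B - {C}"
    using infinite_countable_subset by blast
  then have bB: "b m \<in> B" "b m \<noteq> C" for m
    by auto
  show thesis
  proof (rule that[of "\<lambda>m x. representation B x (b m)" b])
    show "representation B (x + y) (b m) = representation B x (b m) + representation B y (b m)"
      for m x y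
      using B by (simp add: representation_add)
    show "representation B C (b m) = 0" for m
      using B bB(2)[of m] by (simp add: representation_basis)
    show "representation B (b k) (b m) = (if m = k then 1 else 0)" for m k
      using B bB(1)[of k] b(1) by (simp add: representation_basis inj_eq)
  qed
qed

text \<open>The vertex \<open>x i\<close> is the sum of those \<open>b m\<close> for which digit
  \<open>m\<close> of \<open>i\<close> is 1; each new direction appends a translated copy of the
  previous cube.\<close>

lemma exists_cube_enumeration:
  "\<exists>x :: nat \<Rightarrow> 'v. x 0 = 0 \<and> (\<forall>m<n. \<forall>i<2 ^ m. x (i + 2 ^ m) = x i + b m)"
proof (induction n)
  case (Suc n)
  then obtain x :: "nat \<Rightarrow> 'v" where x: "x 0 = 0"
    "\<And>m i. m < n \<Longrightarrow> i < 2 ^ m \<Longrightarrow> x (i + 2 ^ m) = x i + b m"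
    by blast
  define y where "y i = (if i < 2 ^ n then x i else x (i - 2 ^ n) + b n)" for i
  have "y (i + 2 ^ m) = y i + b m" if "m < Suc n" "i < 2 ^ m" for m i
  proof (cases "m = n")
    case False
    then have "m < n"
      using that by simp
    then have "(2::nat) ^ Suc m \<le> 2 ^ n"
      by (intro power_increasing) auto
    then show ?thesis
      using that(2) x(2)[OF \<open>m < n\<close>] by (simp add: y_def)
  qed (use that in \<open>simp add: y_def\<close>)
  moreover have "y 0 = 0"
    using x(1) by (simp add: y_def)
  ultimately show ?case by blast
qed auto

text \<open>On the cube spanned by \<open>b 0\<close>, ..., \<open>b (n - 1)\<close>, the product of
  the first \<open>n\<close> coordinates is 1 only at the last vertex. The shear along it therefore
  changes the vertex sum from \<open>0\<close> to \<open>C\<close>.\<close>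

lemma not_preserves_zero_cubes:
  assumes "countably_infinite_dimensional scale" and "C \<noteq> 0" and "2 \<le> n"
  obtains g where "g \<in> shears C (Suc n)" and "\<not> preserves g (zero_cubes C n)"
proof -
  obtain b :: "nat \<Rightarrow> 'v" and l where l: "\<And>m x y. l m (x + y) = l m x + l m y" "\<And>m. l m C = 0"
    "\<And>m k. l m (b k) = (if m = k then 1 else (0::bit))"
    using exists_coordinates[OF assms(1,2)] by metis
  obtain x :: "nat \<Rightarrow> 'v" where x: "x 0 = 0"
    "\<And>m i. m < n \<Longrightarrow> i < 2 ^ m \<Longrightarrow> x (i + 2 ^ m) = x i + b m"
    using exists_cube_enumeration[of n b] by blast
  define h where "h k y = scale (\<Prod>m<k. l m y) C" for k y
  have h_Suc: "h (Suc k) y = scale (l k y) (h k y)" for k y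
    by (simp only: h_def prod.lessThan_Suc scale_scale mult.commute)
  have range: "h k y \<in> {0, C}" for k y
    unfolding h_def by (rule scale_bit_cases)
  have hC: "h k (y + C) = h k y" for k y
    by (simp only: h_def l add_0_right)
  \<comment> \<open>Only coordinates below \<open>k\<close> enter \<open>h k\<close>, and they
    vanish on \<open>b k\<close>.\<close>
  have hb: "h k (y + b k) = h k y" for k y
    unfolding h_def by (intro arg_cong2[where f = scale] prod.cong refl) (simp only: l, simp)
  have poly: "poly_fun (Suc k) (h k)" for k
  proof (induction k)
    case 0
    then show ?case by (simp add: h_def)
  next
    case (Suc k)
    then show ?case
      using poly_fun_mult_additive[of "l k", OF l(1) Suc.IH] by (simp only: h_Suc[abs_def])
  qed
  \<comment> \<open>The first \<open>2 ^ m\<close> vertices are sums of vectors \<open>b j\<close>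
    with \<open>j < m\<close>.\<close>
  have l_x: "l k (x i) = 0" if "m \<le> n" "i < 2 ^ m" "m \<le> k" for m k i
    using that
  proof (induction m arbitrary: i)
    case 0
    then show ?case
      using l(1)[of k 0 0] by (simp add: x(1))
  next
    case (Suc m)
    show ?case
    proof (cases "i < 2 ^ m")
      case False
      then have "x i = x (i - 2 ^ m) + b m" "i - 2 ^ m < 2 ^ m"
        using x(2)[of m "i - 2 ^ m"] Suc.prems by auto
      then show ?thesis
        using Suc.IH[of "i - 2 ^ m"] Suc.prems by (simp add: l)
    qed (use Suc in simp)
  qed
  have sum_h: "(\<Sum>i<2 ^ k. h k (x i)) = C" if "k \<le> n" for k
    using that
  proof (induction k)
    case 0
    then show ?case by (simp add: h_def)
  next
    case (Suc k)
    \<comment> \<open>The factor \<open>l k\<close> is 0 on the lower face and 1 on the upper one,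
      so one summand of each pair survives.\<close>
    have "h (Suc k) (x i) + h (Suc k) (x (i + 2 ^ k)) = h k (x i)" if "i < 2 ^ k" for i
    proof -
      have "l k (x i) = 0"
        using l_x[of k i k] Suc.prems that by simp
      moreover have "x (i + 2 ^ k) = x i + b k"
        using x(2)[of k i] Suc.prems that by simp
      ultimately show ?thesis
        by (simp only: h_Suc l hb add_0_left simp_thms if_True scale_zero_left scale_one)
    qed
    then show ?case
      unfolding sum_lessThan_power2_Suc using Suc by simp
  qed
  define xs where "xs = map x [0..<2 ^ n]"
  have len: "length xs = 2 ^ n" and nth: "\<And>i. i < 2 ^ n \<Longrightarrow> xs ! i = x i"
    by (simp_all add: xs_def)
  \<comment> \<open>Pairing opposite vertices leaves \<open>2 ^ (n - 1)\<close> copies of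
    \<open>b (n - 1)\<close>. Their number is even because \<open>n >= 2\<close>; for
    \<open>n = 1\<close> the sum would be \<open>b 0\<close>.\<close>
  obtain k where n: "n = Suc (Suc k)"
    using assms(3) by (metis Suc_le_D numeral_2_eq_2 Suc_le_mono)
  have "(\<Sum>i<2 ^ n. xs ! i) = (\<Sum>i<2 ^ n. x i)"
    by (simp add: nth)
  also have "\<dots> = (\<Sum>i<(2::nat) ^ Suc k. b (Suc k))"
    unfolding n sum_lessThan_power2_Suc[of x "Suc k"]
    by (rule sum.cong) (simp_all add: x(2)[of "Suc k"] n del: power_Suc)
  also have "\<dots> = 0"
    unfolding sum_lessThan_power2_Suc by simp
  finally have sum: "(\<Sum>i<2 ^ n. xs ! i) = 0" .
  have "xs ! i + xs ! (i + 2 ^ m) + xs ! 0 + xs ! (2 ^ m) = 0" if "m < n" "i < 2 ^ m" for m i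
  proof -
    have "(2::nat) ^ Suc m \<le> 2 ^ n"
      using that(1) by (intro power_increasing) auto
    then have lt: "i < 2 ^ n" "i + 2 ^ m < 2 ^ n" "0 < (2::nat) ^ n" "(2::nat) ^ m < 2 ^ n"
      using that by auto
    show ?thesis
      unfolding lt[THEN nth] using x(2)[OF that(1), of 0] x(2)[OF that] x(1) by simp
  qed
  then have "cube_mod C n ((!) xs)"
    by (simp add: cube_mod_def)
  with sum have "xs \<in> zero_cubes C n"
    by (simp add: zero_cubes_def len)
  moreover have "map (\<lambda>y. y + h n y) xs \<notin> zero_cubes C n"
  proof -
    have "(\<Sum>i<2 ^ n. map (\<lambda>y. y + h n y) xs ! i) = C"
      using sum sum_h[of n] by (simp add: len nth sum.distrib)
    then show ?thesis
      using assms(2) by (simp add: zero_cubes_def)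
  qed
  moreover have "(\<lambda>y. y + h n y) \<in> shears C (Suc n)"
    unfolding shears_def using range hC poly by blast
  ultimately show thesis
    using that unfolding preserves_def by blast
qed


section \<open>The chain of reducts\<close>

definition shear_reduct :: "'v \<Rightarrow> nat \<Rightarrow> 'v rels" where
  "shear_reduct C n = {(k, R). fo_definable (pointed_vector_space scale C) k R \<and>
     (\<forall>g\<in>shears C n. preserves g R)}"

lemma shear_reduct_antimono: "n \<le> m \<Longrightarrow> shear_reduct C m \<subseteq> shear_reduct C n"
  unfolding shear_reduct_def using shears_mono by blast

lemma fo_reduct_shear_reduct: "fo_reduct (shear_reduct C n) (pointed_vector_space scale C)"
  by (auto simp: fo_reduct_def shear_reduct_def)

text \<open>Allowing every \<open>m > n\<close>, not just the successor, makes the classes in the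
  chain pairwise distinct and thus the lattice infinite.\<close>

lemma not_fo_reduct_shear_reduct:
  assumes "countably_infinite_dimensional scale" and "C \<noteq> 0" and "2 \<le> n" and "n < m"
  shows "\<not> fo_reduct (shear_reduct C n) (rel_structure (shear_reduct C m))"
proof
  assume red: "fo_reduct (shear_reduct C n) (rel_structure (shear_reduct C m))"
  have "(2 ^ n, zero_cubes C n) \<in> shear_reduct C n"
    by (simp add: shear_reduct_def fo_definable_zero_cubes preserves_zero_cubes)
  with red have def: "fo_definable (rel_structure (shear_reduct C m)) (2 ^ n) (zero_cubes C n)"
    by (auto simp: fo_reduct_def)
  obtain g where "g \<in> shears C (Suc n)" and not_pres: "\<not> preserves g (zero_cubes C n)"
    using not_preserves_zero_cubes[OF assms(1-3)] .
  then have g: "g \<in> shears C m"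
    using shears_mono[of "Suc n" m C] assms(4) by auto
  have "preserves g (zero_cubes C n)"
    using def bij_shear[OF g] by (rule fo_definable_preserves) (use g in \<open>auto simp: shear_reduct_def\<close>)
  with not_pres show False ..
qed

end

theorem theorem2p8:
  fixes scale :: "bit \<Rightarrow> 'v::ab_group_add \<Rightarrow> 'v" and C :: 'v
  assumes "vector_space scale"
    and "countably_infinite_dimensional scale"
    and "C \<noteq> 0"
  shows "(\<exists>X :: nat \<Rightarrow> 'v rels set.
            (\<forall>i. X i \<in> reduct_lattice (pointed_vector_space scale C)) \<and>
            (\<forall>i. reduct_less (X i) (X (Suc i)))) \<and>
         infinite (reduct_lattice (pointed_vector_space scale C))"
proof -
  interpret bit_vector_space scale
    using assms(1) by (rule bit_vector_space.intro)
  let ?M = "pointed_vector_space scale C"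
  \<comment> \<open>The shift by 2 meets the bound \<open>2 \<le> n\<close> needed to separate
    consecutive members.\<close>
  define \<Gamma> where "\<Gamma> i = shear_reduct C (i + 2)" for i
  define X where "X i = {(\<Gamma>, \<Delta>). fo_reduct \<Gamma> ?M \<and> fo_reduct \<Delta> ?M \<and> fo_equivalent \<Gamma> \<Delta>} `` {\<Gamma> i}"
    for i
  have red: "fo_reduct (\<Gamma> i) ?M" for i
    unfolding \<Gamma>_def by (rule fo_reduct_shear_reduct)
  have le: "fo_reduct (\<Gamma> j) (rel_structure (\<Gamma> i))" if "i \<le> j" for i j
    by (rule fo_reduct_rel_structure_mono[OF _ red])
      (use that shear_reduct_antimono in \<open>simp add: \<Gamma>_def\<close>)
  have mem: "\<Gamma> i \<in> X i" for i
    using red le[of i i] by (simp add: X_def fo_equivalent_def)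
  have neq: "X i \<noteq> X j" if "i < j" for i j
  proof
    assume "X i = X j"
    then have "\<Gamma> j \<in> X i"
      using mem by simp
    then show False
      using not_fo_reduct_shear_reduct[OF assms(2,3), of "i + 2" "j + 2"] that
      by (simp add: X_def fo_equivalent_def \<Gamma>_def)
  qed
  have X: "X i \<in> reduct_lattice ?M" for i
    unfolding reduct_lattice_def X_def using red by (intro quotientI) simp
  moreover have "reduct_less (X i) (X (Suc i))" for i
    unfolding reduct_less_def reduct_le_def using mem le[of i "Suc i"] neq[of i "Suc i"] by auto
  moreover have "inj X"
    by (rule injI) (metis neq linorder_neqE_nat)
  then have "infinite (reduct_lattice ?M)"
    using X infinite_super[of "range X" "reduct_lattice ?M"] range_inj_infinite by blast
  ultimately show ?thesis
    by blast
qed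

end
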